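(* A chordal graph $G$ is $\alpha$-excellent if and only if $G$ has a successive clique-cover.
   Context: All graphs are finite and simple. A graph is chordal if every cycle of length at least four has a chord. A graph is $\alpha$-excellent if every vertex is contained in some maximum independent set. A vertex is simplicial if its neighbors are pairwise adjacent; a simplex of a graph is a maximal complete subgraph containing at least one simplicial vertex of that graph. An ordered sequence $(V_1,\ldots,V_n)$ of subsets of $V(G)$ is a successive clique-cover of $G$ if: (a) $V_1,\ldots,V_n$ form a partition of $V(G)$; (b) for each $i\in\{1,\ldots,n\}$, $G[V_i]$ is a simplex of $G-\bigcup_{j<i}V_j$; (c) for each $i\in\{1,\ldots,n-1\}$ and every $u_i\in V_i$ there are vertices $u_{i+1}\in V_{i+1},\ldots,u_n\in V_n$ such that $\{u_i,u_{i+1},\ldots,u_n\}$ is independent. *)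

theory Defs
  imports Main "HOL-Library.Disjoint_Sets"
begin

record 'a graph =
  verts :: "'a set"
  edges :: "'a set set"

definition finite_simple_graph :: "'a graph \<Rightarrow> bool" where
  "finite_simple_graph G \<longleftrightarrow>
     finite (verts G) \<and> (\<forall>e \<in> edges G. e \<subseteq> verts G \<and> card e = 2)"

definition adjacent :: "'a graph \<Rightarrow> 'a \<Rightarrow> 'a \<Rightarrow> bool" where
  "adjacent G u v \<longleftrightarrow> {u, v} \<in> edges G"

definition neighbors :: "'a graph \<Rightarrow> 'a \<Rightarrow> 'a set" where
  "neighbors G v = {u \<in> verts G. adjacent G v u}"

definition induced_subgraph :: "'a graph \<Rightarrow> 'a set \<Rightarrow> 'a graph" where
  "induced_subgraph G S =
     \<lparr>verts = verts G \<inter> S, edges = {e \<in> edges G. e \<subseteq> S}\<rparr>"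

definition delete_verts :: "'a graph \<Rightarrow> 'a set \<Rightarrow> 'a graph" where
  "delete_verts G S = induced_subgraph G (verts G - S)"

definition subgraph :: "'a graph \<Rightarrow> 'a graph \<Rightarrow> bool" where
  "subgraph H G \<longleftrightarrow>
     finite_simple_graph H \<and> verts H \<subseteq> verts G \<and> edges H \<subseteq> edges G"

definition complete_graph :: "'a graph \<Rightarrow> bool" where
  "complete_graph H \<longleftrightarrow>
     (\<forall>u \<in> verts H. \<forall>v \<in> verts H. u \<noteq> v \<longrightarrow> adjacent H u v)"

(* A cycle is given by its cyclic sequence of pairwise distinct vertices. *)
definition cycle :: "'a graph \<Rightarrow> 'a list \<Rightarrow> bool" where
  "cycle G c \<longleftrightarrow>
     length c \<ge> 3 \<and> distinct c \<and> set c \<subseteq> verts G \<and>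
     (\<forall>i < length c. adjacent G (c ! i) (c ! (Suc i mod length c)))"

definition cycle_edges :: "'a list \<Rightarrow> 'a set set" where
  "cycle_edges c = {{c ! i, c ! (Suc i mod length c)} | i. i < length c}"

definition has_chord :: "'a graph \<Rightarrow> 'a list \<Rightarrow> bool" where
  "has_chord G c \<longleftrightarrow>
     (\<exists>u \<in> set c. \<exists>v \<in> set c. adjacent G u v \<and> {u, v} \<notin> cycle_edges c)"

definition chordal :: "'a graph \<Rightarrow> bool" where
  "chordal G \<longleftrightarrow> (\<forall>c. cycle G c \<and> length c \<ge> 4 \<longrightarrow> has_chord G c)"

definition independent_set :: "'a graph \<Rightarrow> 'a set \<Rightarrow> bool" where
  "independent_set G S \<longleftrightarrow>
     S \<subseteq> verts G \<and> (\<forall>u \<in> S. \<forall>v \<in> S. \<not> adjacent G u v)"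

definition maximum_independent_set :: "'a graph \<Rightarrow> 'a set \<Rightarrow> bool" where
  "maximum_independent_set G S \<longleftrightarrow>
     independent_set G S \<and> (\<forall>T. independent_set G T \<longrightarrow> card T \<le> card S)"

definition alpha_excellent :: "'a graph \<Rightarrow> bool" where
  "alpha_excellent G \<longleftrightarrow>
     (\<forall>v \<in> verts G. \<exists>S. maximum_independent_set G S \<and> v \<in> S)"

definition simplicial :: "'a graph \<Rightarrow> 'a \<Rightarrow> bool" where
  "simplicial G v \<longleftrightarrow>
     v \<in> verts G \<and>
     (\<forall>x \<in> neighbors G v. \<forall>y \<in> neighbors G v. x \<noteq> y \<longrightarrow> adjacent G x y)"

definition maximal_complete_subgraph :: "'a graph \<Rightarrow> 'a graph \<Rightarrow> bool" where
  "maximal_complete_subgraph H G \<longleftrightarrow>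
     subgraph H G \<and> complete_graph H \<and>
     (\<forall>K. subgraph K G \<and> complete_graph K \<and> subgraph H K \<longrightarrow> K = H)"

definition simplex_of :: "'a graph \<Rightarrow> 'a graph \<Rightarrow> bool" where
  "simplex_of H G \<longleftrightarrow>
     maximal_complete_subgraph H G \<and> (\<exists>v \<in> verts H. simplicial G v)"

(* The sequence is indexed from 0. As partition_on concerns the unordered
   collection of blocks, distinctness of the list has to be required separately. *)
definition successive_clique_cover :: "'a graph \<Rightarrow> 'a set list \<Rightarrow> bool" where
  "successive_clique_cover G Vs \<longleftrightarrow>
     (partition_on (verts G) (set Vs) \<and> distinct Vs) \<and>
     (\<forall>i < length Vs.
        simplex_of (induced_subgraph G (Vs ! i))
                   (delete_verts G (\<Union>j < i. Vs ! j))) \<and>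
     (\<forall>i. Suc i < length Vs \<longrightarrow>
        (\<forall>x \<in> Vs ! i. \<exists>u. u i = x \<and>
           (\<forall>j \<in> {i<..<length Vs}. u j \<in> Vs ! j) \<and>
           independent_set G (u ` {i..<length Vs})))"

end

theory Submission
  imports Defs
begin

text \<open>
  Any simplicial vertex of the simplex \<open>V\<^sub>i\<close> of the remaining graph has no neighbour in a later block,
  so an independent transversal of \<open>V\<^sub>i, \<dots>, V\<^sub>n\<close> extends to one of all blocks; as the blocks are
  cliques, such transversals are exactly the maximum independent sets. Conversely, deleting the closed
  neighbourhood of a simplicial vertex lowers the independence number by one and preserves
  \<open>\<alpha>\<close>-excellence, which gives the cover by induction. Chordality only enters to provide simplicial
  vertices: if \<open>U\<close> is a maximal connected set whose closed neighbourhood misses a nonempty set \<open>B\<close>, then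
  every vertex of \<open>N(U)\<close> is adjacent to all of \<open>B\<close>, hence \<open>N(U)\<close> is a clique (a shortest path through
  \<open>U\<close> closes to a chordless cycle at a vertex of \<open>B\<close>), and a simplicial vertex of \<open>G[B]\<close> is simplicial
  in \<open>G\<close>.
\<close>

section \<open>Adjacency, induced subgraphs and vertex deletion\<close>

lemma adjacent_sym: "adjacent G u v \<longleftrightarrow> adjacent G v u"
  by (simp add: adjacent_def insert_commute)

lemma adjacent_irrefl: "finite_simple_graph G \<Longrightarrow> \<not> adjacent G u u"
  by (auto simp: adjacent_def finite_simple_graph_def)

lemma adjacent_verts:
  "finite_simple_graph G \<Longrightarrow> adjacent G u v \<Longrightarrow> u \<in> verts G \<and> v \<in> verts G"
  by (auto simp: adjacent_def finite_simple_graph_def)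

lemma verts_induced [simp]: "verts (induced_subgraph G S) = verts G \<inter> S"
  by (simp add: induced_subgraph_def)

lemma adjacent_induced [simp]:
  "adjacent (induced_subgraph G S) u v \<longleftrightarrow> adjacent G u v \<and> u \<in> S \<and> v \<in> S"
  by (auto simp: induced_subgraph_def adjacent_def)

lemma verts_delete [simp]: "verts (delete_verts G S) = verts G - S"
  by (auto simp: delete_verts_def)

lemma adjacent_delete [simp]:
  "adjacent (delete_verts G S) u v \<longleftrightarrow> adjacent G u v \<and> u \<in> verts G - S \<and> v \<in> verts G - S"
  by (auto simp: delete_verts_def)

lemma finite_simple_induced:
  "finite_simple_graph G \<Longrightarrow> finite_simple_graph (induced_subgraph G S)"
  by (auto simp: finite_simple_graph_def induced_subgraph_def)

lemma finite_simple_delete: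
  "finite_simple_graph G \<Longrightarrow> finite_simple_graph (delete_verts G S)"
  by (simp add: delete_verts_def finite_simple_induced)

lemma chordal_induced:
  assumes "chordal G"
  shows "chordal (induced_subgraph G S)"
  unfolding chordal_def
proof (intro allI impI)
  fix c assume c: "cycle (induced_subgraph G S) c \<and> 4 \<le> length c"
  then have "cycle G c" and S: "set c \<subseteq> S" by (auto simp: cycle_def)
  then have "has_chord G c" using assms c by (auto simp: chordal_def)
  then show "has_chord (induced_subgraph G S) c"
    using S by (auto simp: has_chord_def)
qed

lemma induced_delete:
  assumes "V \<subseteq> verts G - D"
  shows "induced_subgraph (delete_verts G D) V = induced_subgraph G V"
  using assms by (auto simp: delete_verts_def induced_subgraph_def)

lemma delete_empty: "finite_simple_graph G \<Longrightarrow> delete_verts G {} = G"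
  by (auto simp: delete_verts_def induced_subgraph_def finite_simple_graph_def
      intro!: graph.equality)

lemma delete_delete:
  "delete_verts (delete_verts G D) D' = delete_verts G (D \<union> D')"
  by (auto simp: delete_verts_def induced_subgraph_def)

lemma independent_delete: "independent_set (delete_verts G D) S \<Longrightarrow> independent_set G S"
  by (auto simp: independent_set_def subset_iff)

lemma independent_subset: "independent_set G S \<Longrightarrow> T \<subseteq> S \<Longrightarrow> independent_set G T"
  unfolding independent_set_def by blast

section \<open>Simplicial vertices of chordal graphs\<close>

text \<open>A shortest walk from \<open>x\<close> to \<open>y\<close> through \<open>U\<close> has
  length at least 2 if \<open>x\<close> and \<open>y\<close> are not adjacent, so together with
  \<open>b\<close> it closes to a cycle of length at least 4. A chord between two path vertices
  would shorten the walk, and \<open>b\<close> sees only \<open>x\<close> and \<open>y\<close> on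
  it, so this cycle would be chordless.\<close>

lemma chordal_closing_path:
  assumes fin: "finite_simple_graph G" and ch: "chordal G"
    and U: "U \<subseteq> verts G" and b: "b \<in> verts G" "b \<notin> U" "\<And>u. u \<in> U \<Longrightarrow> \<not> adjacent G b u"
    and xy: "x \<noteq> y" "adjacent G b x" "adjacent G b y"
    and path: "(x, y) \<in> {(p, q). adjacent G p q \<and> p \<in> insert x (insert y U) \<and> q \<in> insert x (insert y U)}\<^sup>*"
  shows "adjacent G x y"
proof (rule ccontr)
  assume nadj: "\<not> adjacent G x y"
  define W where "W = insert x (insert y U)"
  define R where "R = {(p, q). adjacent G p q \<and> p \<in> W \<and> q \<in> W}"
  have "\<exists>n. (x, y) \<in> R ^^ n"
    using path by (simp add: R_def W_def rtrancl_power)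
  define n where "n = (LEAST n. (x, y) \<in> R ^^ n)"
  have n: "(x, y) \<in> R ^^ n"
    unfolding n_def using \<open>\<exists>n. (x, y) \<in> R ^^ n\<close> by (rule LeastI_ex)
  have n_le: "n \<le> m" if "(x, y) \<in> R ^^ m" for m
    unfolding n_def using that by (rule Least_le)
  obtain f where f: "f 0 = x" "f n = y" "\<And>i. i < n \<Longrightarrow> (f i, f (Suc i)) \<in> R"
    using n by (auto simp: relpow_fun_conv)
  have n2: "2 \<le> n"
  proof -
    have "n \<noteq> 0" using f(1,2) xy(1) by (intro notI) simp
    moreover have "n \<noteq> 1" using f(1,2) f(3)[of 0] nadj by (auto simp: R_def)
    ultimately show ?thesis by simp
  qed
  have seg: "(f i, f (i + d)) \<in> R ^^ d" if "i + d \<le> n" for i d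
    using that f(3) by (auto simp: relpow_fun_conv intro!: exI[of _ "\<lambda>k. f (i + k)"])
  \<comment> \<open>Replacing the segment from \<open>f i\<close> to \<open>f j\<close> by a walk of
    length \<open>m\<close> gives another walk from \<open>x\<close> to \<open>y\<close>, so
    minimality of \<open>n\<close> applies. With \<open>m = 0\<close> this makes the path vertices
    distinct (\<open>dist\<close>), with \<open>m = 1\<close> it excludes edges between
    non-consecutive ones (\<open>adj_f\<close>).\<close>
  have short: "j - i \<le> m" if "i \<le> j" "j \<le> n" "(f i, f j) \<in> R ^^ m" for i j m
  proof -
    have "(f 0, f (0 + i)) \<in> R ^^ i" "(f j, f (j + (n - j))) \<in> R ^^ (n - j)"
      using seg[of 0 i] seg[of j "n - j"] that by auto
    then have "(x, y) \<in> R ^^ (i + (m + (n - j)))"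
      unfolding relpow_add using that f(1,2) by auto
    from n_le[OF this] show ?thesis using that by linarith
  qed
  have fW: "f i \<in> W" if "i \<le> n" for i
    using that f(2) f(3)[of i] by (cases "i = n") (auto simp: W_def R_def)
  have dist: "f i \<noteq> f j" if "i < j" "j \<le> n" for i j
    using short[of i j 0] that by auto
  have adj_f: "j = Suc i" if "i < j" "j \<le> n" "adjacent G (f i) (f j)" for i j
    using short[of i j 1] that fW[of i] fW[of j] by (auto simp: R_def)
  have inj: "f i = f j \<longleftrightarrow> i = j" if "i \<le> n" "j \<le> n" for i j
    using dist that by (metis linorder_neqE_nat)
  have bx: "b \<noteq> x" "b \<noteq> y" using xy adjacent_irrefl[OF fin] by auto
  have W: "W \<subseteq> verts G" "b \<notin> W"
    using U xy adjacent_verts[OF fin] b bx by (auto simp: W_def)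
  define c where "c = b # map f [0..<Suc n]"
  have len: "length c = n + 2" by (simp add: c_def)
  have c0: "c ! 0 = b" by (simp add: c_def)
  have cS: "c ! Suc i = f i" if "i \<le> n" for i
    unfolding c_def using that by (simp del: upt_Suc)
  have setc: "set c = insert b (f ` {..n})"
    unfolding c_def by (auto simp: atLeast0LessThan less_Suc_eq_le simp del: upt_Suc)
  have "distinct c"
    unfolding c_def using fW W inj by (auto simp: distinct_map inj_on_def simp del: upt_Suc)
  moreover have "adjacent G (c ! i) (c ! (Suc i mod length c))" if "i < length c" for i
  proof -
    \<comment> \<open>The three kinds of cycle edges: from \<open>b\<close> to \<open>x\<close>,
      along the path (shifted by one, as \<open>b\<close> has index 0), and the edge from
      \<open>y\<close> back to \<open>b\<close>, the only place where the index wraps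
      around.\<close>
    have "i = 0 \<or> (\<exists>k. i = Suc k \<and> k < n) \<or> i = Suc n"
      using that len by (cases i) auto
    then consider "i = 0" | k where "i = Suc k" "k < n" | "i = Suc n" by blast
    then show ?thesis
    proof cases
      case 1 then show ?thesis using len cS[of 0] c0 f xy by simp
    next
      case 2 then show ?thesis
        using len cS[of k] cS[of "Suc k"] f(3)[of k] by (simp add: R_def)
    next
      case 3 then show ?thesis
        using len cS[of n] c0 f xy adjacent_sym[of G b y] by simp
    qed
  qed
  ultimately have "cycle G c"
    using fW W b n2 by (auto simp: cycle_def setc len)
  then have "has_chord G c" using ch len n2 by (simp add: chordal_def)
  then obtain p q where pq: "p \<in> set c" "q \<in> set c" "adjacent G p q" "{p, q} \<notin> cycle_edges c"
    by (auto simp: has_chord_def)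
  have edge: "{c ! i, c ! (Suc i mod length c)} \<in> cycle_edges c" if "i < length c" for i
    using that by (auto simp: cycle_edges_def)
  have e0: "{b, x} \<in> cycle_edges c" using edge[of 0] len c0 cS[of 0] f by simp
  have en: "{b, y} \<in> cycle_edges c"
    using edge[of "Suc n"] len c0 cS[of n] f by (simp add: insert_commute)
  have ef: "{f i, f (Suc i)} \<in> cycle_edges c" if "i < n" for i
    using edge[of "Suc i"] len cS[of i] cS[of "Suc i"] that by simp
  have bW: "{b, w} \<in> cycle_edges c" if "w \<in> W" "adjacent G b w" for w
    using that b e0 en by (auto simp: W_def)
  have ff: "{f i, f j} \<in> cycle_edges c" if "i < j" "j \<le> n" "adjacent G (f i) (f j)" for i j
    using adj_f[OF that] ef[of i] that by simp
  consider "p = b" "q = b" | "p = b" "q \<in> W" | "q = b" "p \<in> W"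
    | i j where "p = f i" "q = f j" "i \<le> n" "j \<le> n"
    using pq fW by (auto simp: setc)
  then show False
  proof cases
    case 1 then show ?thesis using pq adjacent_irrefl[OF fin] by simp
  next
    case 2 then show ?thesis using pq bW by simp
  next
    case 3 then show ?thesis using pq bW[of p] adjacent_sym[of G] by (simp add: insert_commute)
  next
    case 4
    consider "i < j" | "j < i" | "i = j" by linarith
    then show ?thesis
    proof cases
      case 1 then show ?thesis using 4 pq ff by simp
    next
      case 2 then show ?thesis
        using 4 pq ff[of j i] adjacent_sym[of G p q] by (simp add: insert_commute)
    next
      case 3 then show ?thesis using 4 pq adjacent_irrefl[OF fin] by simp
    qed
  qed
qed

text \<open>The conclusion says that \<open>G[W]\<close> has a simplicial vertex. Inducting over
  vertex sets \<open>W\<close> keeps \<open>G\<close> fixed, so that its chordality can be applied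
  at every stage.\<close>

lemma chordal_simplicial_within:
  assumes fin: "finite_simple_graph G" and ch: "chordal G"
  shows "W \<subseteq> verts G \<Longrightarrow> W \<noteq> {} \<Longrightarrow>
    \<exists>w\<in>W. \<forall>x\<in>W. \<forall>y\<in>W. adjacent G w x \<longrightarrow> adjacent G w y \<longrightarrow> x \<noteq> y \<longrightarrow> adjacent G x y"
proof (induction "card W" arbitrary: W rule: less_induct)
  case less
  have finW: "finite W"
    using less.prems fin finite_subset by (auto simp: finite_simple_graph_def)
  \<comment> \<open>\<open>conn U\<close> means that \<open>G[U]\<close> is connected, and
    \<open>far U\<close> is the part of \<open>W\<close> outside the closed neighbourhood of
    \<open>U\<close>. A maximal member of \<open>F\<close> will be the separating set
    \<open>U\<close>.\<close>
  define A where "A U = {(p, q). adjacent G p q \<and> p \<in> U \<and> q \<in> U}" for U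
  define conn where "conn U \<longleftrightarrow> (\<forall>p\<in>U. \<forall>q\<in>U. (p, q) \<in> (A U)\<^sup>*)" for U
  define far where "far U = {b \<in> W - U. \<forall>u\<in>U. \<not> adjacent G b u}" for U
  define F where "F = {U. U \<subseteq> W \<and> U \<noteq> {} \<and> conn U \<and> far U \<noteq> {}}"
  have A_mono: "(A U)\<^sup>* \<subseteq> (A U')\<^sup>*" if "U \<subseteq> U'" for U U'
    using that by (intro rtrancl_mono) (auto simp: A_def)
  have A_sym: "(p, q) \<in> (A U)\<^sup>* \<Longrightarrow> (q, p) \<in> (A U)\<^sup>*" for p q U
    by (rule symD[OF sym_rtrancl]) (auto simp: A_def sym_def adjacent_sym)
  show ?case
  proof (cases "F = {}")
    case True
    \<comment> \<open>A nonadjacent pair would put the singleton \<open>{x}\<close> into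
      \<open>F\<close>. Hence \<open>W\<close> is a clique and each of its vertices will do.\<close>
    have "adjacent G x y" if "x \<in> W" "y \<in> W" "x \<noteq> y" for x y
    proof (rule ccontr)
      assume "\<not> adjacent G x y"
      then have "y \<in> far {x}" using that adjacent_sym[of G x y] by (auto simp: far_def)
      then have "{x} \<in> F" using that by (auto simp: F_def conn_def)
      then show False using True by simp
    qed
    then show ?thesis using less.prems by blast
  next
    case False
    have "finite F" using finW by (auto simp: F_def intro: finite_subset[of _ "Pow W"])
    from finite_has_maximal[OF this False] obtain U
      where UF: "U \<in> F" and max: "\<And>U'. U' \<in> F \<Longrightarrow> U \<subseteq> U' \<Longrightarrow> U = U'" by blast
    have U: "U \<subseteq> W" "U \<noteq> {}" "conn U" "far U \<noteq> {}" using UF by (auto simp: F_def)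
    define N where "N = {s \<in> W - U. \<exists>u\<in>U. adjacent G s u}"
    have split: "W = U \<union> N \<union> far U" using U by (auto simp: N_def far_def)
    \<comment> \<open>Otherwise \<open>insert s U\<close> is still connected and still far from
      \<open>b\<close>, against the maximality of \<open>U\<close>.\<close>
    have N_far: "adjacent G s b" if s: "s \<in> N" and b: "b \<in> far U" for s b
    proof (rule ccontr)
      assume nadj: "\<not> adjacent G s b"
      obtain u where u: "u \<in> U" "adjacent G s u" using s by (auto simp: N_def)
      have base: "(s, q) \<in> (A (insert s U))\<^sup>*" if "q \<in> U" for q
      proof -
        have "(s, u) \<in> A (insert s U)" using u by (auto simp: A_def)
        moreover have "(u, q) \<in> (A (insert s U))\<^sup>*"
          using subsetD[OF A_mono[OF subset_insertI[of U s]], of "(u, q)"] u U(3) that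
          by (simp add: conn_def)
        ultimately show ?thesis by (rule converse_rtrancl_into_rtrancl)
      qed
      have inner: "(p, q) \<in> (A (insert s U))\<^sup>*" if "p \<in> U" "q \<in> U" for p q
        using subsetD[OF A_mono[OF subset_insertI[of U s]], of "(p, q)"] that U(3)
        by (simp add: conn_def)
      have "conn (insert s U)"
        unfolding conn_def
      proof (intro ballI)
        fix p q assume "p \<in> insert s U" "q \<in> insert s U"
        then show "(p, q) \<in> (A (insert s U))\<^sup>*"
          by (elim insertE) (simp_all add: base A_sym[OF base] inner)
      qed
      moreover have "b \<in> far (insert s U)"
        using b nadj s u adjacent_sym[of G] by (auto simp: far_def N_def)
      ultimately have "insert s U \<in> F" using s U by (auto simp: F_def N_def)
      from max[OF this] show False using s by (auto simp: N_def)
    qed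
    obtain b where b: "b \<in> far U" using U by auto
    have N_clique: "adjacent G x y" if x: "x \<in> N" and y: "y \<in> N" and "x \<noteq> y" for x y
    proof (rule chordal_closing_path[OF fin ch])
      show "U \<subseteq> verts G" using U less.prems by auto
      show "b \<in> verts G" "b \<notin> U" "\<And>u. u \<in> U \<Longrightarrow> \<not> adjacent G b u"
        using b less.prems by (auto simp: far_def)
      show "x \<noteq> y" by fact
      show "adjacent G b x" "adjacent G b y"
        using N_far b x y adjacent_sym[of G] by auto
      let ?W = "insert x (insert y U)"
      \<comment> \<open>The required path leaves \<open>x\<close> to a neighbour in
        \<open>U\<close>, runs inside the connected set \<open>U\<close>, and ends by stepping from
        a neighbour of \<open>y\<close> to \<open>y\<close>.\<close>
      obtain u u' where u: "u \<in> U" "adjacent G x u" "u' \<in> U" "adjacent G y u'"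
        using x y by (auto simp: N_def)
      have xu: "(x, u) \<in> A ?W" and uy: "(u', y) \<in> A ?W"
        using u adjacent_sym[of G] by (auto simp: A_def)
      have "(u, u') \<in> (A ?W)\<^sup>*"
        using subsetD[OF A_mono[of U ?W], of "(u, u')"] u U(3) by (auto simp: conn_def)
      from converse_rtrancl_into_rtrancl[OF xu rtrancl_into_rtrancl[OF this uy]]
      have "(x, y) \<in> (A ?W)\<^sup>*" .
      then show "(x, y) \<in> {(p, q). adjacent G p q \<and> p \<in> ?W \<and> q \<in> ?W}\<^sup>*"
        by (simp add: A_def)
    qed
    have "far U \<subset> W" using U by (auto simp: far_def)
    then have "card (far U) < card W" using finW by (rule psubset_card_mono[rotated])
    moreover have "far U \<subseteq> verts G" using \<open>far U \<subset> W\<close> less.prems(1) by blast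
    ultimately have "\<exists>w\<in>far U. \<forall>x\<in>far U. \<forall>y\<in>far U.
        adjacent G w x \<longrightarrow> adjacent G w y \<longrightarrow> x \<noteq> y \<longrightarrow> adjacent G x y"
      using U(4) by (rule less.hyps)
    then obtain w where w: "w \<in> far U"
      and ws: "\<And>x y. x \<in> far U \<Longrightarrow> y \<in> far U \<Longrightarrow> adjacent G w x \<Longrightarrow> adjacent G w y
        \<Longrightarrow> x \<noteq> y \<Longrightarrow> adjacent G x y"
      by blast
    \<comment> \<open>Since \<open>w\<close> is far from \<open>U\<close>, its neighbours in
      \<open>W\<close> lie in the clique \<open>N\<close> or in \<open>far U\<close>. These two
      parts are completely joined, and within \<open>far U\<close> the induction hypothesis
      applies.\<close>
    have nbr: "x \<in> N \<or> x \<in> far U" if "x \<in> W" "adjacent G w x" for x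
    proof -
      have "x \<notin> U" using that w by (auto simp: far_def)
      moreover have "x \<in> U \<union> N \<union> far U" using that(1) split by simp
      ultimately show ?thesis by simp
    qed
    have "adjacent G x y" if "x \<in> W" "y \<in> W" "adjacent G w x" "adjacent G w y" "x \<noteq> y" for x y
      using nbr[OF that(1,3)] nbr[OF that(2,4)]
    proof (elim disjE)
      assume "x \<in> N" "y \<in> N" then show ?thesis using N_clique that(5) by simp
    next
      assume "x \<in> N" "y \<in> far U" then show ?thesis using N_far by simp
    next
      assume "x \<in> far U" "y \<in> N"
      then show ?thesis using N_far[of y x] adjacent_sym[of G x y] by simp
    next
      assume "x \<in> far U" "y \<in> far U" then show ?thesis using ws that by simp
    qed
    then show ?thesis using w by (auto simp: far_def)
  qed
qed

lemma chordal_ex_simplicial: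
  assumes "finite_simple_graph G" "chordal G" "verts G \<noteq> {}"
  obtains v where "simplicial G v"
  using chordal_simplicial_within[OF assms(1,2) subset_refl assms(3)]
  by (auto simp: simplicial_def neighbors_def)

section \<open>Simplices and successive clique-covers\<close>

text \<open>If \<open>s\<close> is simplicial and \<open>x\<close> is a neighbour of
  \<open>s\<close>, then \<open>x\<close> is adjacent to all other vertices of the clique
  \<open>V\<close>, so \<open>insert x V\<close> is again a clique and maximality forces
  \<open>x\<close> into \<open>V\<close>. Thus a simplex is the closed neighbourhood of its
  simplicial vertex.\<close>

lemma simplex_ofD:
  assumes fin: "finite_simple_graph H" and V: "V \<subseteq> verts H"
    and simp: "simplex_of (induced_subgraph H V) H"
  obtains s where "s \<in> V" "\<And>x. adjacent H s x \<Longrightarrow> x \<in> V"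
    and "\<And>x y. x \<in> V \<Longrightarrow> y \<in> V \<Longrightarrow> x \<noteq> y \<Longrightarrow> adjacent H x y"
proof -
  from simp V obtain s where s: "s \<in> V" "simplicial H s"
    and comp: "complete_graph (induced_subgraph H V)"
    and max: "\<And>K. subgraph K H \<Longrightarrow> complete_graph K \<Longrightarrow> subgraph (induced_subgraph H V) K
      \<Longrightarrow> K = induced_subgraph H V"
    by (auto simp: simplex_of_def maximal_complete_subgraph_def)
  have clique: "adjacent H x y" if "x \<in> V" "y \<in> V" "x \<noteq> y" for x y
    using comp that V by (auto simp: complete_graph_def)
  have "x \<in> V" if x: "adjacent H s x" for x
  proof -
    let ?K = "induced_subgraph H (insert x V)"
    have xH: "x \<in> verts H" using adjacent_verts[OF fin x] by simp
    have xV: "adjacent H x y" if "y \<in> V" "y \<noteq> x" for y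
    proof (cases "y = s")
      case True then show ?thesis using x adjacent_sym[of H] by simp
    next
      case False
      then have "adjacent H s y" using clique s that by auto
      then show ?thesis using s x xH that V by (auto simp: simplicial_def neighbors_def)
    qed
    have "?K = induced_subgraph H V"
    proof (rule max)
      show "subgraph ?K H"
        using finite_simple_induced[OF fin] by (auto simp: subgraph_def induced_subgraph_def)
      show "complete_graph ?K"
        using clique xV adjacent_sym[of H] by (auto simp: complete_graph_def)
      show "subgraph (induced_subgraph H V) ?K"
        using finite_simple_induced[OF fin] by (auto simp: subgraph_def induced_subgraph_def)
    qed
    then have "verts ?K = verts (induced_subgraph H V)" by simp
    then show ?thesis using xH by auto
  qed
  then show ?thesis using that s clique by blast
qed

text \<open>Maximality holds because a complete subgraph containing \<open>s\<close> has all its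
  other vertices among the neighbours of \<open>s\<close>.\<close>

lemma simplex_of_closed_neighborhood:
  assumes fin: "finite_simple_graph H" and s: "simplicial H s"
  shows "simplex_of (induced_subgraph H (insert s (neighbors H s))) H"
proof -
  let ?V = "insert s (neighbors H s)"
  let ?I = "induced_subgraph H ?V"
  have V: "?V \<subseteq> verts H" using s by (auto simp: simplicial_def neighbors_def)
  have clique: "adjacent H x y" if "x \<in> ?V" "y \<in> ?V" "x \<noteq> y" for x y
    using that s adjacent_sym[of H] by (auto simp: simplicial_def neighbors_def)
  have "K = ?I" if K: "subgraph K H" "complete_graph K" "subgraph ?I K" for K
  proof -
    have sK: "s \<in> verts K" and VK: "?V \<subseteq> verts K"
      using K V by (auto simp: subgraph_def)
    have KV: "verts K \<subseteq> ?V"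
    proof
      fix x assume x: "x \<in> verts K"
      show "x \<in> ?V"
      proof (cases "x = s")
        case False
        then have "adjacent K s x" using K x sK by (auto simp: complete_graph_def)
        then show ?thesis using K x by (auto simp: subgraph_def adjacent_def neighbors_def)
      qed simp
    qed
    \<comment> \<open>Maximality is about graphs, so the edge sets must be compared too. Every edge
      of \<open>K\<close> has its ends in \<open>?V\<close>, hence is an edge of
      \<open>?I\<close>.\<close>
    have "edges K \<subseteq> edges ?I"
      using K KV by (auto simp: subgraph_def finite_simple_graph_def induced_subgraph_def)
    moreover have "edges ?I \<subseteq> edges K" using K by (simp add: subgraph_def)
    moreover have "verts K = verts ?I" using VK KV V by auto
    ultimately show ?thesis by (intro graph.equality) auto
  qed
  moreover have "subgraph ?I H"
    using finite_simple_induced[OF fin] by (auto simp: subgraph_def induced_subgraph_def)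
  moreover have "complete_graph ?I" using clique by (auto simp: complete_graph_def)
  moreover have "s \<in> verts ?I" using V by auto
  ultimately show ?thesis
    using s unfolding simplex_of_def maximal_complete_subgraph_def by blast
qed

section \<open>From a successive clique-cover to maximum independent sets\<close>

lemma cover_disjoint:
  assumes "successive_clique_cover G Vs" "i < length Vs" "j < length Vs" "i \<noteq> j"
  shows "Vs ! i \<inter> Vs ! j = {}"
  using assms unfolding successive_clique_cover_def partition_on_def
  by (metis disjointD nth_eq_iff_index_eq nth_mem)

lemma cover_verts:
  assumes "successive_clique_cover G Vs"
  shows "verts G = (\<Union>i<length Vs. Vs ! i)"
proof -
  have "verts G = \<Union> (set Vs)"
    using assms by (simp add: successive_clique_cover_def partition_on_def)
  also have "\<dots> = (\<Union>i<length Vs. Vs ! i)"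
    unfolding set_conv_nth by blast
  finally show ?thesis .
qed

text \<open>The later blocks survive in the graph \<open>?H\<close> in which block \<open>i\<close>
  is a simplex, and a simplicial vertex of that simplex has all its \<open>?H\<close>-neighbours
  inside the block.\<close>

lemma cover_block:
  assumes fin: "finite_simple_graph G" and cov: "successive_clique_cover G Vs"
    and i: "i < length Vs"
  obtains s where "s \<in> Vs ! i"
    and "\<And>j y. i < j \<Longrightarrow> j < length Vs \<Longrightarrow> y \<in> Vs ! j \<Longrightarrow> \<not> adjacent G s y"
    and "\<And>x y. x \<in> Vs ! i \<Longrightarrow> y \<in> Vs ! i \<Longrightarrow> x \<noteq> y \<Longrightarrow> adjacent G x y"
proof -
  let ?D = "\<Union>j<i. Vs ! j"
  let ?H = "delete_verts G ?D"
  have later: "Vs ! j \<subseteq> verts G - ?D" if "i \<le> j" "j < length Vs" for j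
  proof -
    have "Vs ! j \<inter> Vs ! k = {}" if "k < i" for k
      using cover_disjoint[OF cov, of j k] that \<open>i \<le> j\<close> \<open>j < length Vs\<close> by simp
    then show ?thesis using cover_verts[OF cov] that by blast
  qed
  have "simplex_of (induced_subgraph ?H (Vs ! i)) ?H"
    using cov i later[of i] induced_delete[of "Vs ! i" G ?D]
    by (simp add: successive_clique_cover_def)
  moreover have "Vs ! i \<subseteq> verts ?H" using later[of i] i by auto
  ultimately obtain s where s: "s \<in> Vs ! i" "\<And>x. adjacent ?H s x \<Longrightarrow> x \<in> Vs ! i"
    and cl: "\<And>x y. x \<in> Vs ! i \<Longrightarrow> y \<in> Vs ! i \<Longrightarrow> x \<noteq> y \<Longrightarrow> adjacent ?H x y"
    using simplex_ofD[OF finite_simple_delete[OF fin]] by metis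
  show ?thesis
  proof
    show "s \<in> Vs ! i" by fact
    show "\<not> adjacent G s y" if "i < j" "j < length Vs" "y \<in> Vs ! j" for j y
    proof
      assume "adjacent G s y"
      then have "adjacent ?H s y"
        using later[of i] later[of j] i s(1) that by auto
      then have "y \<in> Vs ! i" by (rule s(2))
      then show False using cover_disjoint[OF cov, of i j] that by auto
    qed
    show "adjacent G x y" if "x \<in> Vs ! i" "y \<in> Vs ! i" "x \<noteq> y" for x y
      using cl[OF that] by simp
  qed
qed

text \<open>Condition (c) supplies the choice from block \<open>i\<close> onwards. Each earlier
  block contributes a vertex without neighbours in any later block, which cannot create an
  edge.\<close>

lemma cover_transversal:
  assumes fin: "finite_simple_graph G" and cov: "successive_clique_cover G Vs"
    and i: "i < length Vs" and x: "x \<in> Vs ! i"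
  obtains S where "x \<in> S" "independent_set G S" "card S = length Vs"
proof -
  let ?n = "length Vs"
  \<comment> \<open>Bundling both properties lets a single choice function \<open>s\<close> satisfy
    them together.\<close>
  define Q where "Q j w \<longleftrightarrow> w \<in> Vs ! j \<and>
    (\<forall>k y. j < k \<longrightarrow> k < ?n \<longrightarrow> y \<in> Vs ! k \<longrightarrow> \<not> adjacent G w y)" for j w
  have "\<exists>w. Q j w" if "j < ?n" for j
    using cover_block[OF fin cov that] unfolding Q_def by metis
  then obtain s where "\<And>j. j < ?n \<Longrightarrow> Q j (s j)" by metis
  then have s: "\<And>j. j < ?n \<Longrightarrow> s j \<in> Vs ! j"
    "\<And>j k y. j < k \<Longrightarrow> k < ?n \<Longrightarrow> y \<in> Vs ! k \<Longrightarrow> \<not> adjacent G (s j) y"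
    by (auto simp: Q_def)
  obtain u where u: "u i = x" "\<And>j. i \<le> j \<Longrightarrow> j < ?n \<Longrightarrow> u j \<in> Vs ! j"
    "independent_set G (u ` {i..<?n})"
  proof (cases "Suc i < ?n")
    case True
    then obtain u where "u i = x" "\<forall>j\<in>{i<..<?n}. u j \<in> Vs ! j"
      "independent_set G (u ` {i..<?n})"
      using cov x unfolding successive_clique_cover_def by blast
    then show ?thesis using that[of u] x by (metis greaterThanLessThan_iff le_neq_implies_less)
  next
    case False
    \<comment> \<open>Condition (c) is silent about the last block; there \<open>x\<close> alone is
      the transversal.\<close>
    then have "{i..<?n} = {i}" using i by auto
    then show ?thesis
      using x i False cover_verts[OF cov] adjacent_irrefl[OF fin]
      by (intro that[of "\<lambda>_. x"]) (auto simp: independent_set_def dest: le_neq_implies_less)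
  qed
  define t where "t j = (if j < i then s j else u j)" for j
  have t: "t j \<in> Vs ! j" if "j < ?n" for j using that s u by (auto simp: t_def)
  have lt: "\<not> adjacent G (t j) (t k)" if "j < k" "k < ?n" for j k
  proof (cases "j < i")
    case True then show ?thesis using s(2)[OF that t] that by (simp add: t_def)
  next
    case False then show ?thesis using u(3) that by (auto simp: t_def independent_set_def)
  qed
  show ?thesis
  proof
    show "x \<in> t ` {..<?n}" using u(1) i by (force simp: t_def)
    have "\<not> adjacent G (t j) (t k)" if "j < ?n" "k < ?n" for j k
      using lt[of j k] lt[of k j] that adjacent_irrefl[OF fin] adjacent_sym[of G]
      by (metis linorder_neqE_nat)
    then show "independent_set G (t ` {..<?n})"
      using t cover_verts[OF cov] by (auto simp: independent_set_def)
    have "inj_on t {..<?n}"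
    proof (rule inj_onI, rule ccontr)
      fix j k assume "j \<in> {..<?n}" "k \<in> {..<?n}" "t j = t k" "j \<noteq> k"
      then show False using t[of j] t[of k] cover_disjoint[OF cov, of j k] by auto
    qed
    then show "card (t ` {..<?n}) = ?n" by (simp add: card_image)
  qed
qed

text \<open>Sending each vertex of \<open>T\<close> to the index of its block is injective because
  blocks are cliques. If the cardinalities agree, this map is onto the indices, so every block is
  met.\<close>

lemma independent_card_cover:
  assumes fin: "finite_simple_graph G" and cov: "successive_clique_cover G Vs"
    and T: "independent_set G T"
  shows "card T \<le> length Vs"
    and "card T = length Vs \<Longrightarrow> i < length Vs \<Longrightarrow> T \<inter> Vs ! i \<noteq> {}"
proof -
  have "\<forall>t\<in>T. \<exists>i<length Vs. t \<in> Vs ! i"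
    using T cover_verts[OF cov] by (auto simp: independent_set_def)
  then obtain b where b: "\<And>t. t \<in> T \<Longrightarrow> b t < length Vs \<and> t \<in> Vs ! b t" by metis
  have inj: "inj_on b T"
  proof (rule inj_onI, rule ccontr)
    fix x y assume xy: "x \<in> T" "y \<in> T" "b x = b y" "x \<noteq> y"
    have "adjacent G x y"
      using cover_block[OF fin cov, of "b x"] b[of x] b[of y] xy by metis
    then show False using T xy by (auto simp: independent_set_def)
  qed
  have sub: "b ` T \<subseteq> {..<length Vs}" using b by auto
  show "card T \<le> length Vs"
    using card_inj_on_le[OF inj sub] by simp
  assume "card T = length Vs" "i < length Vs"
  then have "b ` T = {..<length Vs}"
    using sub card_image[OF inj] by (intro card_subset_eq) auto
  then obtain t where "t \<in> T" "b t = i" using \<open>i < length Vs\<close> by (metis imageE lessThan_iff)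
  then show "T \<inter> Vs ! i \<noteq> {}" using b[of t] by auto
qed

lemma cover_imp_alpha_excellent:
  assumes fin: "finite_simple_graph G" and cov: "successive_clique_cover G Vs"
  shows "alpha_excellent G"
  unfolding alpha_excellent_def
proof
  fix x assume "x \<in> verts G"
  then obtain i where "i < length Vs" "x \<in> Vs ! i" using cover_verts[OF cov] by auto
  from cover_transversal[OF fin cov this] obtain S
    where "x \<in> S" "independent_set G S" "card S = length Vs" .
  then show "\<exists>S. maximum_independent_set G S \<and> x \<in> S"
    using independent_card_cover(1)[OF fin cov] by (auto simp: maximum_independent_set_def)
qed

section \<open>From \<alpha>-excellence to a successive clique-cover\<close>

text \<open>Prepending \<open>V\<close> shifts all indices by one: the conditions for later blocks
  are inherited from \<open>delete_verts G V\<close>, and \<open>tr\<close> is condition (c) for the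
  new first block.\<close>

lemma successive_clique_cover_Cons:
  assumes fin: "finite_simple_graph G" and V: "V \<subseteq> verts G" "V \<noteq> {}"
    and simp: "simplex_of (induced_subgraph G V) G"
    and cov: "successive_clique_cover (delete_verts G V) Vs"
    and tr: "\<And>x. x \<in> V \<Longrightarrow> \<exists>u. (\<forall>j<length Vs. u j \<in> Vs ! j) \<and>
      independent_set G (insert x (u ` {..<length Vs}))"
  shows "successive_clique_cover G (V # Vs)"
proof -
  let ?G' = "delete_verts G V"
  have part: "partition_on (verts G - V) (set Vs)" "distinct Vs"
    using cov by (auto simp: successive_clique_cover_def)
  have sub: "Vs ! i \<subseteq> verts G - V" if "i < length Vs" for i
    using part that by (auto simp: partition_on_def)
  have "V \<notin> set Vs" using part V by (auto simp: partition_on_def)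
  moreover have "partition_on (verts G) (insert V (set Vs))"
  proof -
    have "disjoint (insert V (set Vs))"
      using part by (auto simp: partition_on_def disjoint_def)
    then show ?thesis using part V by (auto simp: partition_on_def)
  qed
  moreover have "simplex_of (induced_subgraph G ((V # Vs) ! i))
      (delete_verts G (\<Union>j<i. (V # Vs) ! j))" if "i < length (V # Vs)" for i
  proof (cases i)
    case 0
    then show ?thesis using simp delete_empty[OF fin] by simp
  next
    case (Suc k)
    have "(\<Union>j<Suc k. (V # Vs) ! j) = V \<union> (\<Union>j<k. Vs ! j)"
      by (simp add: lessThan_Suc_eq_insert_0 image_image)
    moreover have "simplex_of (induced_subgraph ?G' (Vs ! k)) (delete_verts ?G' (\<Union>j<k. Vs ! j))"
      using cov that Suc unfolding successive_clique_cover_def by simp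
    ultimately show ?thesis
      using Suc that induced_delete[OF sub[of k]] by (simp add: delete_delete)
  qed
  moreover have "\<exists>u. u i = x \<and> (\<forall>j\<in>{i<..<length (V # Vs)}. u j \<in> (V # Vs) ! j) \<and>
      independent_set G (u ` {i..<length (V # Vs)})"
    if i: "Suc i < length (V # Vs)" "x \<in> (V # Vs) ! i" for i x
  proof (cases i)
    case 0
    then obtain u where u: "\<forall>j<length Vs. u j \<in> Vs ! j"
      "independent_set G (insert x (u ` {..<length Vs}))"
      using tr[of x] i by auto
    \<comment> \<open>\<open>case_nat x u\<close> takes the value \<open>x\<close> at 0 and follows
      the shifted transversal \<open>u\<close> afterwards.\<close>
    have "case_nat x u ` {0..<Suc (length Vs)} = insert x (u ` {..<length Vs})"
      by (simp add: atLeast0LessThan lessThan_Suc_eq_insert_0 image_image)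
    then show ?thesis
      using u 0 by (intro exI[of _ "case_nat x u"]) (auto simp: nth_Cons split: nat.split)
  next
    case (Suc k)
    then have "Suc k < length Vs" "x \<in> Vs ! k" using i by auto
    with cov obtain u where u: "u k = x" "\<forall>j\<in>{k<..<length Vs}. u j \<in> Vs ! j"
      "independent_set ?G' (u ` {k..<length Vs})"
      unfolding successive_clique_cover_def by blast
    have "(\<lambda>j. u (j - 1)) ` {Suc k..<Suc (length Vs)} = u ` {k..<length Vs}"
      by (simp only: image_Suc_atLeastLessThan[symmetric] image_image diff_Suc_1)
    then show ?thesis
      using u Suc independent_delete[OF u(3)] by (intro exI[of _ "\<lambda>j. u (j - 1)"])
        (auto simp: nth_Cons split: nat.split)
  qed
  ultimately show ?thesis
    using part unfolding successive_clique_cover_def by simp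
qed

lemma independent_insert_simplicial:
  assumes fin: "finite_simple_graph G" and "v \<in> verts G"
    and T: "independent_set (delete_verts G (insert v (neighbors G v))) T"
  shows "independent_set G (insert v T)" "card (insert v T) = Suc (card T)"
proof -
  have "finite T" "v \<notin> T"
    using fin T finite_subset by (auto simp: independent_set_def finite_simple_graph_def)
  then show "card (insert v T) = Suc (card T)" by simp
  show "independent_set G (insert v T)"
    using T assms(2) adjacent_irrefl[OF fin] adjacent_sym[of G _ v]
    by (auto simp: independent_set_def neighbors_def subset_iff)
qed

text \<open>A maximum independent set \<open>S\<close> through \<open>y\<close> loses at most one
  vertex to the clique \<open>?V\<close>, whereas any independent set of the remaining graph can be
  enlarged by \<open>v\<close>. Hence \<open>S - ?V\<close> is maximum there, and it still contains
  \<open>y\<close>.\<close>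

lemma alpha_excellent_delete_simplex:
  assumes fin: "finite_simple_graph G" and ex: "alpha_excellent G" and v: "simplicial G v"
  shows "alpha_excellent (delete_verts G (insert v (neighbors G v)))"
    (is "alpha_excellent (delete_verts G ?V)")
  unfolding alpha_excellent_def
proof
  have vG: "v \<in> verts G" using v by (simp add: simplicial_def)
  have clique: "adjacent G x y" if "x \<in> ?V" "y \<in> ?V" "x \<noteq> y" for x y
    using that v adjacent_sym[of G] by (auto simp: simplicial_def neighbors_def)
  fix y assume y: "y \<in> verts (delete_verts G ?V)"
  then obtain S where S: "maximum_independent_set G S" "y \<in> S"
    using ex by (auto simp: alpha_excellent_def)
  have ind: "independent_set G S" using S by (simp add: maximum_independent_set_def)
  then have finS: "finite S"
    using fin finite_subset by (auto simp: independent_set_def finite_simple_graph_def)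
  have "p = q" if "p \<in> S \<inter> ?V" "q \<in> S \<inter> ?V" for p q
    using clique[of p q] that ind unfolding independent_set_def by blast
  then have "card (S \<inter> ?V) \<le> 1" using finS by (simp add: card_le_Suc0_iff_eq)
  then have cS: "card S \<le> Suc (card (S - ?V))"
    using card_Int_Diff[OF finS, of ?V] by simp
  have "independent_set (delete_verts G ?V) (S - ?V)"
    using ind by (auto simp: independent_set_def)
  moreover have "card T \<le> card (S - ?V)" if T: "independent_set (delete_verts G ?V) T" for T
  proof -
    have "card (insert v T) \<le> card S"
      using S independent_insert_simplicial(1)[OF fin vG T] by (simp add: maximum_independent_set_def)
    then show ?thesis using cS independent_insert_simplicial(2)[OF fin vG T] by simp
  qed
  ultimately show "\<exists>S. maximum_independent_set (delete_verts G ?V) S \<and> y \<in> S"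
    using S y by (intro exI[of _ "S - ?V"]) (auto simp: maximum_independent_set_def)
qed

lemma alpha_excellent_imp_cover:
  assumes "finite_simple_graph G" "chordal G" "alpha_excellent G"
  shows "\<exists>Vs. successive_clique_cover G Vs"
  using assms
proof (induction "card (verts G)" arbitrary: G rule: less_induct)
  case (less G)
  note fin = less.prems(1) and ch = less.prems(2) and ex = less.prems(3)
  show ?case
  proof (cases "verts G = {}")
    case True
    then have "successive_clique_cover G []"
      by (simp add: successive_clique_cover_def partition_on_def)
    then show ?thesis ..
  next
    case False
    then obtain v where v: "simplicial G v" using chordal_ex_simplicial[OF fin ch] by blast
    define V where "V = insert v (neighbors G v)"
    define G' where "G' = delete_verts G V"
    have V: "V \<subseteq> verts G" "v \<in> V" "v \<in> verts G"
      using v by (auto simp: V_def simplicial_def neighbors_def)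
    have clique: "adjacent G x y" if "x \<in> V" "y \<in> V" "x \<noteq> y" for x y
      using that v adjacent_sym[of G] by (auto simp: V_def simplicial_def neighbors_def)
    have fin': "finite_simple_graph G'" using finite_simple_delete[OF fin] by (simp add: G'_def)
    have "verts G' \<subset> verts G" using V by (auto simp: G'_def)
    then have "card (verts G') < card (verts G)"
      using fin by (intro psubset_card_mono) (auto simp: finite_simple_graph_def)
    moreover have "chordal G'" using chordal_induced[OF ch] by (simp add: G'_def delete_verts_def)
    moreover have "alpha_excellent G'"
      using alpha_excellent_delete_simplex[OF fin ex v] by (simp add: G'_def V_def)
    ultimately obtain Vs where cov: "successive_clique_cover G' Vs" using less.hyps fin' by blast
    \<comment> \<open>\<open>T\<close> shows that the number of blocks is attained as the size of an
      independent set of \<open>G'\<close>. A transversal needs a vertex to start from, so an empty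
      cover is treated apart.\<close>
    obtain T where T: "independent_set G' T" "card T = length Vs"
    proof (cases Vs)
      case Nil
      then show ?thesis using that[of "{}"] by (simp add: independent_set_def)
    next
      case (Cons B Bs)
      then obtain x where "x \<in> Vs ! 0"
        using cov by (auto simp: successive_clique_cover_def partition_on_def)
      then show ?thesis using cover_transversal[OF fin' cov, of 0 x] Cons that by auto
    qed
    have "successive_clique_cover G (V # Vs)"
    proof (rule successive_clique_cover_Cons[OF fin])
      show "V \<subseteq> verts G" "V \<noteq> {}" using V by auto
      show "simplex_of (induced_subgraph G V) G"
        using simplex_of_closed_neighborhood[OF fin v] by (simp add: V_def)
      show "successive_clique_cover (delete_verts G V) Vs" using cov by (simp add: G'_def)
      fix x assume x: "x \<in> V"
      then obtain S where S: "maximum_independent_set G S" "x \<in> S"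
        using ex V by (auto simp: alpha_excellent_def)
      have ind: "independent_set G S" using S by (simp add: maximum_independent_set_def)
      then have "finite S"
        using fin finite_subset by (auto simp: independent_set_def finite_simple_graph_def)
      have "S \<inter> V \<subseteq> {x}"
      proof
        fix z assume "z \<in> S \<inter> V"
        then show "z \<in> {x}"
          using clique[of z x] ind x S(2) by (cases "z = x") (auto simp: independent_set_def)
      qed
      then have ind': "independent_set G' (S - {x})"
        using ind by (auto simp: independent_set_def G'_def)
      \<comment> \<open>Adding \<open>v\<close> to \<open>T\<close> bounds \<open>card S\<close>
        from below, and the block count bounds \<open>card (S - {x})\<close> from above. So
        \<open>S - {x}\<close> has exactly \<open>length Vs\<close> elements and meets every block,
        which yields the transversal \<open>u\<close>.\<close>
      have "Suc (card T) \<le> card S"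
        using S independent_insert_simplicial[OF fin V(3), of T] T
        by (metis G'_def V_def maximum_independent_set_def)
      then have "card (S - {x}) = length Vs"
        using independent_card_cover(1)[OF fin' cov ind'] T S \<open>finite S\<close> by simp
      then have "\<forall>j<length Vs. \<exists>w. w \<in> (S - {x}) \<inter> Vs ! j"
        using independent_card_cover(2)[OF fin' cov ind'] by blast
      then obtain u where u: "\<And>j. j < length Vs \<Longrightarrow> u j \<in> (S - {x}) \<inter> Vs ! j" by metis
      then have "insert x (u ` {..<length Vs}) \<subseteq> S" using S by auto
      then have "independent_set G (insert x (u ` {..<length Vs}))"
        using ind independent_subset by blast
      then show "\<exists>u. (\<forall>j<length Vs. u j \<in> Vs ! j) \<and>
          independent_set G (insert x (u ` {..<length Vs}))"
        using u by blast
    qed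
    then show ?thesis ..
  qed
qed

theorem theorem4p6:
  fixes G :: "'a graph"
  assumes "finite_simple_graph G"
    and "chordal G"
  shows "alpha_excellent G \<longleftrightarrow> (\<exists>Vs. successive_clique_cover G Vs)"
  using assms alpha_excellent_imp_cover cover_imp_alpha_excellent by blast

end
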